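(* Near unconditionality for lower coefficients (NULC) is a strictly weaker property than either near unconditionality or lattice partial unconditionality (LPU). That is: every nearly unconditional basis is NULC and every LPU basis is NULC; there is a NULC basis that is not nearly unconditional; and there is a NULC basis that is not LPU.
   Context: $\mathbb{N}$ is the set of positive integers; scalars are real or complex. A basis of a quasi-Banach space $X$ is a norm-bounded sequence $(x_n)_{n=1}^\infty$ in $X$ whose linear span is dense in $X$ and for which there is a (unique) norm-bounded sequence $(x_n^* )_{n=1}^\infty$ in $X^*$ with $x_n^*(x_k)=\delta_{n,k}$. For finite $A\subset\mathbb{N}$, $S_A(f)=\sum_{n\in A}x_n^*(f)x_n$. For $f\in X$ put $\|f\|_\infty=\sup_n|x_n^*(f)|$ and, for $0<a\le b<\infty$, $A(f,a,b)=\{n\in\mathbb{N}:a\le|x_n^*(f)|\le b\}$ (a finite set). The basis is: - nearly unconditional if for each $t\in(0,1]$ there is $C\in(0,\infty)$ such that $\|S_A(f)\|\le C\|f\|$ for all $f\in X$, all $s\in(0,\infty)$ with $\|f\|_\infty\le s$, and all $A\subset A(f,ts,s)$; - nearly unconditional for lower coefficients (NULC) if for each $t\in(0,1]$ there is $C\in(0,\infty)$ such that $\|S_A(f)\|\le C\|f\|$ for all $s\in(0,\infty)$, all $f\in X$ with $f=S_{A(f,ts,s)}(f)$, and all $A\subset A(f,ts,s)$; - lattice partially unconditional (LPU) if there is $C\in[1,\infty)$ such that $\|\sum_{n\in A}b_nx_n\|\le C\|\sum_{n\in A}a_nx_n\|$ for all finite $A\subset\mathbb{N}$ and all scalar families $(a_n)_{n\in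 A}$, $(b_n)_{n\in A}$ with $\sup_{n\in A}|b_n|\le\inf_{n\in A}|a_n|$. *)

theory Defs
  imports Complex_Main "HOL-Library.Function_Algebras"
begin

text \<open>
  A space is a linear subspace \<open>X\<close> of an ambient vector space, so that one can quantify
  existentially over spaces. The scalar field is instantiated to \<open>real\<close> and \<open>complex\<close> only.
\<close>

locale quasi_banach_space = vector_space scale
  for scale :: "'k::real_normed_field \<Rightarrow> 'v::ab_group_add \<Rightarrow> 'v" +
  fixes X :: "'v set" and qnorm :: "'v \<Rightarrow> real"
  assumes subspace_X: "subspace X"
    and qnorm_nonneg: "f \<in> X \<Longrightarrow> 0 \<le> qnorm f"
    and qnorm_eq_0: "f \<in> X \<Longrightarrow> qnorm f = 0 \<longleftrightarrow> f = 0"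
    and qnorm_scale: "f \<in> X \<Longrightarrow> qnorm (scale c f) = norm c * qnorm f"
    and quasi_triangle:
      "\<exists>\<kappa>\<ge>1. \<forall>f\<in>X. \<forall>g\<in>X. qnorm (f + g) \<le> \<kappa> * (qnorm f + qnorm g)"
    and complete:
      "\<lbrakk>\<And>n. u n \<in> X; \<forall>e>0. \<exists>M. \<forall>m\<ge>M. \<forall>n\<ge>M. qnorm (u m - u n) < e\<rbrakk>
        \<Longrightarrow> \<exists>f\<in>X. (\<lambda>n. qnorm (u n - f)) \<longlonglongrightarrow> 0"

text \<open>
  Bases are indexed from 0. The coordinate functionals \<open>xs n\<close> are a parameter; only their values
  on \<open>X\<close> are relevant, and these are determined by \<open>x\<close> (lemma \<open>coordinates_unique\<close> below).
  Assumption \<open>xs_bounded\<close> says that they lie in the dual of \<open>X\<close> and are norm bounded there.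
\<close>

locale quasi_banach_basis = quasi_banach_space scale X qnorm
  for scale :: "'k::real_normed_field \<Rightarrow> 'v::ab_group_add \<Rightarrow> 'v"
    and X :: "'v set" and qnorm :: "'v \<Rightarrow> real" +
  fixes x :: "nat \<Rightarrow> 'v" and xs :: "nat \<Rightarrow> 'v \<Rightarrow> 'k"
  assumes x_in_X: "x n \<in> X"
    and x_bounded: "\<exists>C. \<forall>n. qnorm (x n) \<le> C"
    and span_dense: "\<lbrakk>f \<in> X; 0 < e\<rbrakk> \<Longrightarrow> \<exists>g\<in>span (range x). qnorm (f - g) < e"
    and xs_add: "\<lbrakk>f \<in> X; g \<in> X\<rbrakk> \<Longrightarrow> xs n (f + g) = xs n f + xs n g"
    and xs_scale: "f \<in> X \<Longrightarrow> xs n (scale c f) = c * xs n f"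
    and xs_bounded: "\<exists>C. \<forall>n. \<forall>f\<in>X. norm (xs n f) \<le> C * qnorm f"
    and biorthogonal: "xs n (x k) = (if n = k then 1 else 0)"
begin

definition proj :: "nat set \<Rightarrow> 'v \<Rightarrow> 'v" where
  "proj A f = (\<Sum>n\<in>A. scale (xs n f) (x n))"

definition coef_sup :: "'v \<Rightarrow> real" where
  "coef_sup f = (SUP n. norm (xs n f))"

definition level_set :: "'v \<Rightarrow> real \<Rightarrow> real \<Rightarrow> nat set" where
  "level_set f a b = {n. a \<le> norm (xs n f) \<and> norm (xs n f) \<le> b}"

definition nearly_unconditional :: bool where
  "nearly_unconditional \<longleftrightarrow>
    (\<forall>t. 0 < t \<and> t \<le> 1 \<longrightarrow>
      (\<exists>C>0. \<forall>f\<in>X. \<forall>s>0. coef_sup f \<le> s \<longrightarrow>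
        (\<forall>A \<subseteq> level_set f (t * s) s. qnorm (proj A f) \<le> C * qnorm f)))"

definition nulc :: bool where
  "nulc \<longleftrightarrow>
    (\<forall>t. 0 < t \<and> t \<le> 1 \<longrightarrow>
      (\<exists>C>0. \<forall>s>0. \<forall>f\<in>X. f = proj (level_set f (t * s) s) f \<longrightarrow>
        (\<forall>A \<subseteq> level_set f (t * s) s. qnorm (proj A f) \<le> C * qnorm f)))"

text \<open>For empty \<open>A\<close> the supremum and infimum below are junk, but both sums are then 0.\<close>

definition lpu :: bool where
  "lpu \<longleftrightarrow>
    (\<exists>C\<ge>1. \<forall>A a b. finite A \<and> (SUP n\<in>A. norm (b n)) \<le> (INF n\<in>A. norm (a n)) \<longrightarrow>
      qnorm (\<Sum>n\<in>A. scale (b n) (x n)) \<le> C * qnorm (\<Sum>n\<in>A. scale (a n) (x n)))"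

lemma span_subset_X: "span (range x) \<subseteq> X"
  by (rule span_minimal) (use x_in_X subspace_X in auto)

lemma coordinates_unique:
  assumes "quasi_banach_basis scale X qnorm x ys" and f: "f \<in> X"
  shows "ys n f = xs n f"
proof -
  interpret Y: quasi_banach_basis scale X qnorm x ys by fact
  have eq: "ys n g = xs n g \<and> g \<in> X" if "g \<in> span (range x)" for g
    using that
  proof (induction rule: span_induct_alt)
    case base
    show ?case
      using xs_scale[of 0 n 0] Y.xs_scale[of 0 n 0] subspace_0[OF subspace_X] by simp
  next
    case (step c b y)
    then obtain k where k: "b = x k" by auto
    have "scale c (x k) \<in> X" using subspace_scale[OF subspace_X x_in_X] .
    then show ?case using step k
      by (simp add: xs_add Y.xs_add xs_scale Y.xs_scale x_in_X biorthogonal Y.biorthogonal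
          subspace_add[OF subspace_X])
  qed
  obtain C where C: "\<And>n f. f \<in> X \<Longrightarrow> norm (xs n f) \<le> C * qnorm f" using xs_bounded by blast
  obtain D where D: "\<And>n f. f \<in> X \<Longrightarrow> norm (ys n f) \<le> D * qnorm f" using Y.xs_bounded by blast
  define K where "K = \<bar>C\<bar> + \<bar>D\<bar> + 1"
  have "norm (ys n f - xs n f) \<le> 0 + e" if "e > 0" for e
  proof -
    have K: "K > 0" by (simp add: K_def)
    with that have "e / K > 0" by simp
    from span_dense[OF f this] obtain g where g: "g \<in> span (range x)" "qnorm (f - g) < e / K"
      by auto
    have gX: "g \<in> X" and h: "f - g \<in> X"
      using g span_subset_X f subspace_diff[OF subspace_X] by auto
    have "ys n f - xs n f = ys n (f - g) - xs n (f - g)"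
      using xs_add[OF h gX, of n] Y.xs_add[OF h gX, of n] eq[OF g(1)] by simp
    then have "norm (ys n f - xs n f) \<le> norm (ys n (f - g)) + norm (xs n (f - g))"
      by (simp add: norm_triangle_ineq4)
    also have "\<dots> \<le> (D + C) * qnorm (f - g)" using C[OF h, of n] D[OF h, of n]
      by (simp add: algebra_simps)
    also have "\<dots> \<le> K * qnorm (f - g)"
      by (rule mult_right_mono) (auto simp: K_def qnorm_nonneg[OF h])
    also have "\<dots> \<le> e" using g(2) K by (simp add: field_simps)
    finally show ?thesis by simp
  qed
  then have "norm (ys n f - xs n f) \<le> 0" by (rule field_le_epsilon)
  then show ?thesis by simp
qed

lemma finite_level_set:
  assumes f: "f \<in> X" and a: "0 < a"
  shows "finite (level_set f a b)"
proof -
  have supp: "finite {n. xs n g \<noteq> 0} \<and> g \<in> X" if "g \<in> span (range x)" for g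
    using that
  proof (induction rule: span_induct_alt)
    case base
    show ?case using xs_scale[of 0 _ 0] subspace_0[OF subspace_X] by simp
  next
    case (step c b y)
    then obtain k where k: "b = x k" by auto
    have m: "scale c (x k) \<in> X" using subspace_scale[OF subspace_X x_in_X] .
    have "{n. xs n (scale c (x k) + y) \<noteq> 0} \<subseteq> insert k {n. xs n y \<noteq> 0}"
      using step m by (auto simp: xs_add xs_scale x_in_X biorthogonal split: if_splits)
    then show ?case using step k m subspace_add[OF subspace_X]
      by (auto intro: finite_subset)
  qed
  obtain C where C: "\<And>n f. f \<in> X \<Longrightarrow> norm (xs n f) \<le> C * qnorm f" using xs_bounded by blast
  define K where "K = \<bar>C\<bar> + 1"
  have K: "K > 0" by (simp add: K_def)
  with a have "a / K > 0" by simp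
  from span_dense[OF f this] obtain g where g: "g \<in> span (range x)" "qnorm (f - g) < a / K"
    by auto
  have gX: "g \<in> X" and h: "f - g \<in> X"
    using g span_subset_X f subspace_diff[OF subspace_X] by auto
  have "norm (xs n f) < a" if "xs n g = 0" for n
  proof -
    have "norm (xs n f) = norm (xs n (f - g))" using xs_add[OF h gX, of n] that by simp
    also have "\<dots> \<le> C * qnorm (f - g)" by (rule C[OF h])
    also have "\<dots> \<le> K * qnorm (f - g)"
      by (rule mult_right_mono) (auto simp: K_def qnorm_nonneg[OF h])
    also have "\<dots> < a" using g(2) K by (simp add: field_simps)
    finally show ?thesis .
  qed
  then have "level_set f a b \<subseteq> {n. xs n g \<noteq> 0}" by (force simp: level_set_def)
  then show ?thesis using supp[OF g(1)] by (auto intro: finite_subset)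
qed

lemma bdd_above_coef: "f \<in> X \<Longrightarrow> bdd_above (range (\<lambda>n. norm (xs n f)))"
  using xs_bounded by (auto simp: bdd_above_def)

end

text \<open>
  A space with a basis is separable, so its dimension is at most that of the space of all scalar
  sequences, and it is linearly isomorphic to a subspace of the latter. Hence these subspaces, with
  arbitrary quasi-norms, exhaust all quasi-Banach spaces with a basis up to isometry.
\<close>

definition seq_scale :: "'k::real_normed_field \<Rightarrow> (nat \<Rightarrow> 'k) \<Rightarrow> nat \<Rightarrow> 'k" where
  "seq_scale c f = (\<lambda>n. c * f n)"

end

theory Submission
  imports Defs
begin

text \<open>
  For the two counterexamples write a sequence as a pair \<open>(a, b)\<close> and take as quasi-norm the
  maximum of the supremum norm of \<open>(a, b)\<close>, the \<open>l\<^sub>1\<close>-norm of the defect \<open>a - T b\<close>, and possibly a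
  quasi-norm of \<open>b\<close>, where \<open>T\<close> is unbounded, so that \<open>a = T b\<close> makes the quasi-norm small while
  the projection \<open>(a, 0)\<close> is large. The basis is still NULC if this cannot
  happen when all nonzero coefficients of \<open>(a, b)\<close> are comparable.

  \<^item> Not nearly unconditional: \<open>T\<close> sums \<open>b\<close> over dyadic blocks, and \<open>b\<close> carries the weak \<open>l\<^sub>1\<close>
    quasi-norm. On vectors with comparable coefficients it is equivalent to the \<open>l\<^sub>1\<close>-norm, which controls \<open>T b\<close>,
    but \<open>b\<^sub>j = 1 / j\<close> has weak norm 1 and every \<open>(T b)\<^sub>n\<close> lies between 1/2 and 1.
  \<^item> Not LPU: \<open>(T b)\<^sub>n = b\<^sub>n / sqrt (n + 1)\<close>. Once \<open>sqrt (n + 1) > 2 / t\<close>, coefficients with ratio at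
    least \<open>t\<close> cannot cancel, but \<open>a\<^sub>n = 1\<close>, \<open>b\<^sub>n = sqrt (n + 1)\<close> for \<open>n < N\<close> has norm \<open>sqrt N\<close>,
    against \<open>N\<close> for \<open>(a, 0)\<close>.
\<close>

section \<open>The implications\<close>

context quasi_banach_basis
begin

lemma lincomb_in_X: "(\<Sum>k\<in>A. scale (c k) (x k)) \<in> X"
  by (intro subspace_sum subspace_scale subspace_X x_in_X)

lemma xs_lincomb:
  assumes "finite A"
  shows "xs n (\<Sum>k\<in>A. scale (c k) (x k)) = (if n \<in> A then c n else 0)"
  using assms
proof (induction A rule: finite_induct)
  case empty
  show ?case using xs_scale[OF x_in_X, of n 0 n] by simp
next
  case (insert k A)
  have "scale (c k) (x k) \<in> X" by (intro subspace_scale subspace_X x_in_X)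
  with insert show ?case
    by (auto simp: xs_add xs_scale lincomb_in_X x_in_X biorthogonal)
qed

text \<open>A positive lower bound \<open>a\<close> makes the level set finite, so
  \<open>xs_lincomb\<close> can read off the coefficients of the projection. This turns the
  fixed-point hypothesis in NULC into a statement about supports.\<close>

lemma level_set_support:
  assumes f: "f \<in> X" "f = proj (level_set f a b) f" and a: "0 < a"
    and n: "n \<notin> level_set f a b"
  shows "xs n f = 0"
proof -
  have "xs n f = xs n (proj (level_set f a b) f)" using f(2) by simp
  also have "\<dots> = 0"
    using n xs_lincomb[OF finite_level_set[OF f(1) a], of n "\<lambda>k. xs k f" b]
    by (simp add: proj_def)
  finally show ?thesis .
qed

lemma nulc_if_nearly_unconditional:
  assumes nearly_unconditional
  shows nulc
  unfolding nulc_def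
proof (intro allI impI)
  fix t :: real assume t: "0 < t \<and> t \<le> 1"
  with assms obtain C where "C > 0"
    and C: "\<And>f s A. \<lbrakk>f \<in> X; s > 0; coef_sup f \<le> s; A \<subseteq> level_set f (t * s) s\<rbrakk>
      \<Longrightarrow> qnorm (proj A f) \<le> C * qnorm f"
    unfolding nearly_unconditional_def by meson
  have "qnorm (proj A f) \<le> C * qnorm f"
    if *: "s > 0" "f \<in> X" "f = proj (level_set f (t * s) s) f" "A \<subseteq> level_set f (t * s) s" for s f A
  proof (rule C[OF *(2,1) _ *(4)])
    have "norm (xs n f) \<le> s" for n
      using level_set_support[OF *(2,3), of n] * t by (cases "n \<in> level_set f (t * s) s")
        (auto simp: level_set_def)
    then show "coef_sup f \<le> s" unfolding coef_sup_def by (intro cSUP_least) auto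
  qed
  with \<open>C > 0\<close> show "\<exists>C>0. \<forall>s>0. \<forall>f\<in>X. f = proj (level_set f (t * s) s) f \<longrightarrow>
        (\<forall>A \<subseteq> level_set f (t * s) s. qnorm (proj A f) \<le> C * qnorm f)" by blast
qed

text \<open>On the level set the coefficients of \<open>f\<close> have modulus at least
  \<open>t * s\<close>, while those of \<open>t\<close> times the projection have modulus at most
  \<open>t * s\<close>. LPU compares the two, and dividing by \<open>t\<close> gives the constant
  \<open>C / t\<close>.\<close>

lemma nulc_if_lpu:
  assumes lpu
  shows nulc
  unfolding nulc_def
proof (intro allI impI)
  fix t :: real assume t: "0 < t \<and> t \<le> 1"
  from assms obtain C where "C \<ge> 1"
    and C: "\<And>A a b. \<lbrakk>finite A; (SUP n\<in>A. norm (b n)) \<le> (INF n\<in>A. norm (a n))\<rbrakk> \<Longrightarrow>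
      qnorm (\<Sum>n\<in>A. scale (b n) (x n)) \<le> C * qnorm (\<Sum>n\<in>A. scale (a n) (x n))"
    unfolding lpu_def by meson
  have "qnorm (proj A f) \<le> C / t * qnorm f"
    if *: "s > 0" "f \<in> X" "f = proj (level_set f (t * s) s) f" "A \<subseteq> level_set f (t * s) s" for s f A
  proof (cases "level_set f (t * s) s = {}")
    \<comment> \<open>Over an empty level set the supremum and infimum have no useful value, but
      then \<open>f\<close> itself is 0.\<close>
    case True
    with * have "f = 0" "proj A f = 0" by (auto simp: proj_def)
    moreover have "qnorm 0 = 0" using qnorm_eq_0[of 0] subspace_0[OF subspace_X] by simp
    ultimately show ?thesis by simp
  next
    case False
    define L where "L = level_set f (t * s) s"
    have fin: "finite L" unfolding L_def using finite_level_set * t by simp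
    define b where "b n = (if n \<in> A then of_real t * xs n f else 0)" for n
    have L: "t * s \<le> norm (xs n f)" "norm (xs n f) \<le> s" if "n \<in> L" for n
      using that by (auto simp: L_def level_set_def)
    have "(SUP n\<in>L. norm (b n)) \<le> t * s"
    proof (rule cSUP_least)
      show "L \<noteq> {}" using False by (simp add: L_def)
      show "norm (b n) \<le> t * s" if "n \<in> L" for n
        using L[OF that] * t by (auto simp: b_def norm_mult intro: mult_left_mono)
    qed
    also have "\<dots> \<le> (INF n\<in>L. norm (xs n f))"
      by (rule cINF_greatest) (use False L in \<open>auto simp: L_def\<close>)
    finally have "qnorm (\<Sum>n\<in>L. scale (b n) (x n)) \<le> C * qnorm (\<Sum>n\<in>L. scale (xs n f) (x n))"
      by (rule C[OF fin])
    moreover have "(\<Sum>n\<in>L. scale (b n) (x n)) = scale (of_real t) (proj A f)"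
    proof -
      have "(\<Sum>n\<in>L. scale (b n) (x n)) = (\<Sum>n\<in>A. scale (b n) (x n))"
        by (rule sum.mono_neutral_right[OF fin]) (use * in \<open>auto simp: L_def b_def\<close>)
      also have "\<dots> = (\<Sum>n\<in>A. scale (of_real t) (scale (xs n f) (x n)))"
        by (rule sum.cong) (auto simp: b_def)
      finally show ?thesis by (simp add: proj_def scale_sum_right)
    qed
    moreover have "(\<Sum>n\<in>L. scale (xs n f) (x n)) = f" using *(3) by (simp add: L_def proj_def)
    moreover have "proj A f \<in> X" unfolding proj_def by (rule lincomb_in_X)
    ultimately have "t * qnorm (proj A f) \<le> C * qnorm f" using t by (simp add: qnorm_scale)
    then show ?thesis using t by (simp add: field_simps)
  qed
  moreover have "C / t > 0" using \<open>C \<ge> 1\<close> t by simp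
  ultimately show "\<exists>C>0. \<forall>s>0. \<forall>f\<in>X. f = proj (level_set f (t * s) s) f \<longrightarrow>
        (\<forall>A \<subseteq> level_set f (t * s) s. qnorm (proj A f) \<le> C * qnorm f)" by blast
qed

end

section \<open>Sequence spaces defined by families of gauges\<close>

lemma vector_space_seq_scale: "vector_space (seq_scale :: 'k::real_normed_field \<Rightarrow> _)"
  by unfold_locales (auto simp: seq_scale_def algebra_simps fun_eq_iff)

definition unit_seq :: "nat \<Rightarrow> nat \<Rightarrow> 'k::real_normed_field" where
  "unit_seq n = (\<lambda>k. if k = n then 1 else 0)"

text \<open>The quasi-triangle inequality may pass from \<open>p\<close> to other members
  \<open>q\<close> and \<open>r\<close>, because a single weak gauge does not satisfy one; only the
  supremum over the family has to. Continuity under coordinatewise convergence will give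
  completeness, and the last clause bounds the unit vectors.\<close>

definition gauge_family :: "real \<Rightarrow> ((nat \<Rightarrow> 'k::real_normed_field) \<Rightarrow> real) set \<Rightarrow> bool" where
  "gauge_family \<kappa> P \<longleftrightarrow> (\<forall>p\<in>P.
      (\<forall>f. 0 \<le> p f) \<and>
      (\<forall>c f. p (seq_scale c f) = norm c * p f) \<and>
      (\<forall>f g. \<exists>q\<in>P. \<exists>r\<in>P. p (f + g) \<le> \<kappa> * (q f + r g)) \<and>
      (\<forall>u f. (\<forall>n. (\<lambda>k. u k n) \<longlonglongrightarrow> f n) \<longrightarrow> (\<lambda>k. p (u k)) \<longlonglongrightarrow> p f) \<and>
      (\<forall>n. p (unit_seq n) \<le> 1))"

lemma gauge_family_Un:
  assumes "gauge_family \<kappa> P" "gauge_family \<kappa> Q"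
  shows "gauge_family \<kappa> (P \<union> Q)"
  using assms unfolding gauge_family_def Un_iff Bex_def Ball_def by meson

lemma gauge_family_seminorms:
  assumes "1 \<le> \<kappa>"
    and "\<And>p f. p \<in> P \<Longrightarrow> 0 \<le> p f"
    and "\<And>p c f. p \<in> P \<Longrightarrow> p (seq_scale c f) = norm c * p f"
    and "\<And>p f g. p \<in> P \<Longrightarrow> p (f + g) \<le> p f + p g"
    and "\<And>p u f. p \<in> P \<Longrightarrow> \<forall>n. (\<lambda>k. u k n) \<longlonglongrightarrow> f n \<Longrightarrow> (\<lambda>k. p (u k)) \<longlonglongrightarrow> p f"
    and "\<And>p n. p \<in> P \<Longrightarrow> p (unit_seq n) \<le> 1"
  shows "gauge_family \<kappa> P"
proof -
  have "\<exists>q\<in>P. \<exists>r\<in>P. p (f + g) \<le> \<kappa> * (q f + r g)" if p: "p \<in> P" for p f g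
  proof (intro bexI[OF _ p])
    have "p (f + g) \<le> 1 * (p f + p g)" using assms(4)[OF p] by simp
    also have "\<dots> \<le> \<kappa> * (p f + p g)"
      by (rule mult_right_mono) (use assms(1,2) p in \<open>auto intro: add_nonneg_nonneg\<close>)
    finally show "p (f + g) \<le> \<kappa> * (p f + p g)" .
  qed
  with assms show ?thesis unfolding gauge_family_def by blast
qed

text \<open>The coordinate gauges make the supremum of \<open>P\<close> dominate the supremum norm,
  which yields definiteness, bounded coordinate functionals and coordinatewise limits of Cauchy
  sequences.\<close>

locale gauge_space = vector_space "seq_scale :: 'k \<Rightarrow> (nat \<Rightarrow> 'k) \<Rightarrow> nat \<Rightarrow> 'k"
  for P :: "((nat \<Rightarrow> 'k::{real_normed_field,banach}) \<Rightarrow> real) set" and \<kappa> :: real +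
  assumes \<kappa>: "1 \<le> \<kappa>"
    and family: "gauge_family \<kappa> P"
    and coord: "(\<lambda>f. norm (f n)) \<in> P"
begin

text \<open>The closure of the finitely supported sequences. It is phrased with uniform bounds on
  the gauges, since the supremum in \<open>gnorm\<close> is meaningful only where the gauges are
  bounded.\<close>

definition carrier :: "(nat \<Rightarrow> 'k) set" where
  "carrier = {f. \<forall>e>0. \<exists>g\<in>span (range unit_seq). \<forall>p\<in>P. p (f - g) \<le> e}"

definition gnorm :: "(nat \<Rightarrow> 'k) \<Rightarrow> real" where
  "gnorm f = (SUP p\<in>P. p f)"

lemma nonneg: "p \<in> P \<Longrightarrow> 0 \<le> p f"
  and homogeneous: "p \<in> P \<Longrightarrow> p (seq_scale c f) = norm c * p f"
  and quasi_add: "p \<in> P \<Longrightarrow> \<exists>q\<in>P. \<exists>r\<in>P. p (f + g) \<le> \<kappa> * (q f + r g)"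
  and continuous: "p \<in> P \<Longrightarrow> (\<And>n. (\<lambda>k. u k n) \<longlonglongrightarrow> h n) \<Longrightarrow> (\<lambda>k. p (u k)) \<longlonglongrightarrow> p h"
  and unit_le: "p \<in> P \<Longrightarrow> p (unit_seq n) \<le> 1"
  using family unfolding gauge_family_def by blast+

lemma P_nonempty: "P \<noteq> {}"
  using coord by blast

text \<open>The gauges \<open>q\<close> and \<open>r\<close> from the quasi-triangle inequality are
  not known, so the bounds on \<open>f\<close> and \<open>g\<close> are required uniformly over
  \<open>P\<close>.\<close>

lemma add_bound:
  assumes "p \<in> P" "\<And>q. q \<in> P \<Longrightarrow> q f \<le> B" "\<And>q. q \<in> P \<Longrightarrow> q g \<le> C"
  shows "p (f + g) \<le> \<kappa> * (B + C)"
proof -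
  obtain q r where qr: "q \<in> P" "r \<in> P" "p (f + g) \<le> \<kappa> * (q f + r g)"
    using quasi_add[OF assms(1)] by blast
  note qr(3)
  also have "\<kappa> * (q f + r g) \<le> \<kappa> * (B + C)"
    by (intro mult_left_mono add_mono assms qr) (use \<kappa> in simp)
  finally show ?thesis .
qed

lemma zero: "p \<in> P \<Longrightarrow> p 0 = 0"
  using homogeneous[of p 0 0] by (simp add: seq_scale_def zero_fun_def)

lemma minus: "p \<in> P \<Longrightarrow> p (f - g) = p (g - f)"
  using homogeneous[of p "-1" "g - f"] by (simp add: seq_scale_def fun_diff_def)

lemma span_bounded:
  assumes "g \<in> span (range unit_seq)"
  shows "\<exists>B. \<forall>p\<in>P. p g \<le> B"
  using assms
proof (induction rule: span_induct_alt)
  case base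
  show ?case using zero by (metis order_refl)
next
  case (step c b y)
  then obtain n B where n: "b = unit_seq n" and B: "\<And>p. p \<in> P \<Longrightarrow> p y \<le> B" by auto
  have "p (seq_scale c b) \<le> norm c * 1" if "p \<in> P" for p
    unfolding homogeneous[OF that] n by (intro mult_left_mono unit_le that) simp
  then have "p (seq_scale c b + y) \<le> \<kappa> * (norm c * 1 + B)" if "p \<in> P" for p
    by (intro add_bound that B)
  then show ?case by blast
qed

text \<open>A finitely supported approximation within 1 carries its bound over. From here on the
  supremum defining \<open>gnorm\<close> is a genuine one on the carrier.\<close>

lemma carrier_bounded:
  assumes "f \<in> carrier"
  shows "\<exists>B. \<forall>p\<in>P. p f \<le> B"
proof -
  obtain g where g: "g \<in> span (range unit_seq)" "\<And>p. p \<in> P \<Longrightarrow> p (f - g) \<le> 1"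
    using assms zero_less_one unfolding carrier_def by blast
  obtain B where "\<And>p. p \<in> P \<Longrightarrow> p g \<le> B" using span_bounded[OF g(1)] by blast
  then have "p ((f - g) + g) \<le> \<kappa> * (1 + B)" if "p \<in> P" for p
    by (intro add_bound that g(2)) auto
  then show ?thesis by auto
qed

lemma gauge_le_gnorm: "f \<in> carrier \<Longrightarrow> p \<in> P \<Longrightarrow> p f \<le> gnorm f"
  unfolding gnorm_def using carrier_bounded[of f] by (intro cSUP_upper) (auto simp: bdd_above_def)

lemma gnorm_le: "(\<And>p. p \<in> P \<Longrightarrow> p f \<le> B) \<Longrightarrow> gnorm f \<le> B"
  unfolding gnorm_def by (intro cSUP_least P_nonempty)

lemma coord_le_gnorm: "f \<in> carrier \<Longrightarrow> norm (f n) \<le> gnorm f"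
  using gauge_le_gnorm[OF _ coord] .

lemma carrierI:
  assumes "\<And>e. e > 0 \<Longrightarrow> \<exists>g\<in>carrier. \<forall>p\<in>P. p (f - g) \<le> e"
  shows "f \<in> carrier"
  unfolding carrier_def
proof safe
  fix e :: real assume "e > 0"
  \<comment> \<open>Two errors of \<open>e / (2 * \<kappa>)\<close> add up to \<open>e\<close> after
    multiplication by \<open>\<kappa>\<close>.\<close>
  then have e: "e / (2 * \<kappa>) > 0" using \<kappa> by simp
  then obtain g where g: "g \<in> carrier" "\<forall>p\<in>P. p (f - g) \<le> e / (2 * \<kappa>)" using assms by blast
  then obtain h where h: "h \<in> span (range unit_seq)" "\<forall>p\<in>P. p (g - h) \<le> e / (2 * \<kappa>)"
    using e unfolding carrier_def by blast
  have "p ((f - g) + (g - h)) \<le> \<kappa> * (e / (2 * \<kappa>) + e / (2 * \<kappa>))" if "p \<in> P" for p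
    by (intro add_bound that) (use g(2) h(2) in blast)+
  then have "\<forall>p\<in>P. p (f - h) \<le> e" using \<kappa> by simp
  with h show "\<exists>g\<in>span (range unit_seq). \<forall>p\<in>P. p (f - g) \<le> e" by blast
qed

section \<open>Linear structure of the carrier\<close>

lemma span_subset_carrier: "span (range unit_seq) \<subseteq> carrier"
  unfolding carrier_def by (auto intro!: bexI simp: zero)

lemma carrier_subspace: "subspace carrier"
  unfolding subspace_def
proof safe
  show "0 \<in> carrier" using span_subset_carrier span_zero by blast
next
  fix f g assume fg: "f \<in> carrier" "g \<in> carrier"
  show "f + g \<in> carrier"
    unfolding carrier_def
  proof safe
    fix e :: real assume "e > 0"
    then have e: "e / (2 * \<kappa>) > 0" using \<kappa> by simp
    obtain f' where f': "f' \<in> span (range unit_seq)" "\<forall>p\<in>P. p (f - f') \<le> e / (2 * \<kappa>)"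
      using e fg(1) unfolding carrier_def by blast
    obtain g' where g': "g' \<in> span (range unit_seq)" "\<forall>p\<in>P. p (g - g') \<le> e / (2 * \<kappa>)"
      using e fg(2) unfolding carrier_def by blast
    have "p ((f - f') + (g - g')) \<le> \<kappa> * (e / (2 * \<kappa>) + e / (2 * \<kappa>))" if "p \<in> P" for p
      by (intro add_bound that) (use f'(2) g'(2) in blast)+
    then have "\<forall>p\<in>P. p (f + g - (f' + g')) \<le> e" using \<kappa> by (simp add: algebra_simps)
    then show "\<exists>h\<in>span (range unit_seq). \<forall>p\<in>P. p (f + g - h) \<le> e"
      using span_add[OF f'(1) g'(1)] by blast
  qed
next
  fix c f assume f: "f \<in> carrier"
  show "seq_scale c f \<in> carrier"
    unfolding carrier_def
  proof safe
    fix e :: real assume "e > 0"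
    \<comment> \<open>The added 1 keeps the quotient defined when \<open>c\<close> is 0.\<close>
    then have e: "e / (norm c + 1) > 0" by (simp add: add_nonneg_pos)
    obtain g where g: "g \<in> span (range unit_seq)" "\<forall>p\<in>P. p (f - g) \<le> e / (norm c + 1)"
      using e f unfolding carrier_def by blast
    have "p (seq_scale c f - seq_scale c g) \<le> e" if "p \<in> P" for p
    proof -
      have "p (seq_scale c (f - g)) \<le> (norm c + 1) * (e / (norm c + 1))"
        unfolding homogeneous[OF that] by (intro mult_mono) (use that g nonneg in auto)
      also have "\<dots> = e" by (simp add: add_nonneg_eq_0_iff)
      finally show ?thesis by (simp add: scale_right_diff_distrib)
    qed
    then show "\<exists>h\<in>span (range unit_seq). \<forall>p\<in>P. p (seq_scale c f - h) \<le> e"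
      using span_scale[OF g(1)] by blast
  qed
qed

section \<open>Norm axioms and completeness\<close>

lemma gnorm_nonneg: "f \<in> carrier \<Longrightarrow> 0 \<le> gnorm f"
  using coord_le_gnorm[of f 0] norm_ge_zero order_trans by blast

lemma gnorm_scale:
  assumes "f \<in> carrier"
  shows "gnorm (seq_scale c f) = norm c * gnorm f"
proof (rule antisym)
  show "gnorm (seq_scale c f) \<le> norm c * gnorm f"
    by (rule gnorm_le) (metis homogeneous gauge_le_gnorm[OF assms] mult_left_mono norm_ge_zero)
  show "norm c * gnorm f \<le> gnorm (seq_scale c f)"
  proof (cases "c = 0")
    case True
    then show ?thesis using gnorm_nonneg[OF subspace_scale[OF carrier_subspace assms], of c] by simp
  next
    case False
    have "gnorm f \<le> gnorm (seq_scale c f) / norm c"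
    proof (rule gnorm_le)
      fix p assume "p \<in> P"
      then have "norm c * p f \<le> gnorm (seq_scale c f)"
        using gauge_le_gnorm[OF subspace_scale[OF carrier_subspace assms]] homogeneous by metis
      then show "p f \<le> gnorm (seq_scale c f) / norm c" using False by (simp add: field_simps)
    qed
    then show ?thesis using False by (simp add: field_simps)
  qed
qed

text \<open>A Cauchy sequence converges coordinatewise. Letting the second index tend to infinity in
  \<open>p (u m - u k) \<le> e\<close> transfers the bound to the limit for each gauge separately;
  since \<open>M\<close> does not depend on \<open>p\<close>, the bound is uniform over
  \<open>P\<close>.\<close>

lemma gnorm_complete:
  assumes u: "\<And>n. u n \<in> carrier"
    and cauchy: "\<forall>e>0. \<exists>M. \<forall>m\<ge>M. \<forall>n\<ge>M. gnorm (u m - u n) < e"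
  shows "\<exists>f\<in>carrier. (\<lambda>n. gnorm (u n - f)) \<longlonglongrightarrow> 0"
proof -
  have diff: "u m - u n \<in> carrier" for m n using subspace_diff[OF carrier_subspace u u] .
  have "Cauchy (\<lambda>k. u k n)" for n
  proof (rule CauchyI)
    fix e :: real assume "e > 0"
    then obtain M where M: "\<forall>m\<ge>M. \<forall>n\<ge>M. gnorm (u m - u n) < e" using cauchy by blast
    have "norm (u k n - u l n) < e" if "k \<ge> M" "l \<ge> M" for k l
      using coord_le_gnorm[OF diff, of k l n] M that by (auto intro: le_less_trans)
    then show "\<exists>M. \<forall>k\<ge>M. \<forall>l\<ge>M. norm (u k n - u l n) < e" by blast
  qed
  then obtain f where f: "\<And>n. (\<lambda>k. u k n) \<longlonglongrightarrow> f n"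
    unfolding Cauchy_convergent_iff convergent_def by metis
  have close: "\<exists>M. \<forall>m\<ge>M. \<forall>p\<in>P. p (u m - f) \<le> e" if e: "e > 0" for e
  proof -
    obtain M where M: "\<forall>m\<ge>M. \<forall>n\<ge>M. gnorm (u m - u n) < e" using cauchy e by blast
    have "p (u m - f) \<le> e" if "m \<ge> M" "p \<in> P" for m p
    proof (rule tendsto_upperbound)
      show "(\<lambda>k. p (u m - u k)) \<longlonglongrightarrow> p (u m - f)"
        by (rule continuous[OF \<open>p \<in> P\<close>]) (auto intro!: tendsto_intros f)
      have "p (u m - u k) \<le> e" if "k \<ge> M" for k
        using gauge_le_gnorm[OF diff \<open>p \<in> P\<close>, of m k] M \<open>m \<ge> M\<close> that
        by (meson less_imp_le order_trans)
      then show "\<forall>\<^sub>F k in sequentially. p (u m - u k) \<le> e"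
        unfolding eventually_sequentially by blast
    qed simp
    then show ?thesis by blast
  qed
  have "f \<in> carrier"
  proof (rule carrierI)
    fix e :: real assume "e > 0"
    then obtain M where "\<forall>p\<in>P. p (u M - f) \<le> e" using close by blast
    then have "\<forall>p\<in>P. p (f - u M) \<le> e" by (simp add: minus[of _ f])
    then show "\<exists>g\<in>carrier. \<forall>p\<in>P. p (f - g) \<le> e" using u by blast
  qed
  moreover have "(\<lambda>n. gnorm (u n - f)) \<longlonglongrightarrow> 0"
  proof (rule LIMSEQ_I)
    fix e :: real assume "e > 0"
    then obtain M where M: "\<forall>m\<ge>M. \<forall>p\<in>P. p (u m - f) \<le> e / 2" using close[of "e / 2"] by auto
    have "norm (gnorm (u m - f) - 0) < e" if "m \<ge> M" for m
    proof -
      have "gnorm (u m - f) \<le> e / 2" by (rule gnorm_le) (use M that in blast)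
      moreover have "0 \<le> gnorm (u m - f)"
        by (intro gnorm_nonneg subspace_diff[OF carrier_subspace] u \<open>f \<in> carrier\<close>)
      ultimately show ?thesis using \<open>e > 0\<close> by simp
    qed
    then show "\<exists>M. \<forall>m\<ge>M. norm (gnorm (u m - f) - 0) < e" by blast
  qed
  ultimately show ?thesis by blast
qed

sublocale quasi_banach_basis seq_scale carrier gnorm unit_seq "\<lambda>n f. f n"
proof unfold_locales
  show "subspace carrier" by (rule carrier_subspace)
  show "0 \<le> gnorm f" if "f \<in> carrier" for f using gnorm_nonneg that .
  show "gnorm f = 0 \<longleftrightarrow> f = 0" if "f \<in> carrier" for f
  proof
    assume "gnorm f = 0"
    then have "f n = 0" for n using coord_le_gnorm[OF that, of n] by simp
    then show "f = 0" by auto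
  next
    assume f: "f = 0"
    have "gnorm f \<le> 0" by (rule gnorm_le) (metis f zero order_refl)
    with gnorm_nonneg[OF that] show "gnorm f = 0" by (rule antisym[rotated])
  qed
  show "gnorm (seq_scale c f) = norm c * gnorm f" if "f \<in> carrier" for c f
    using gnorm_scale that .
  show "\<exists>\<kappa>\<ge>1. \<forall>f\<in>carrier. \<forall>g\<in>carrier. gnorm (f + g) \<le> \<kappa> * (gnorm f + gnorm g)"
    using \<kappa> by (intro exI[of _ \<kappa>]) (auto intro!: gnorm_le add_bound gauge_le_gnorm)
  show "\<exists>f\<in>carrier. (\<lambda>n. gnorm (u n - f)) \<longlonglongrightarrow> 0"
    if "\<And>n. u n \<in> carrier" "\<forall>e>0. \<exists>M. \<forall>m\<ge>M. \<forall>n\<ge>M. gnorm (u m - u n) < e" for u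
    using gnorm_complete[OF that] .
  show "unit_seq n \<in> carrier" for n using span_subset_carrier span_base by blast
  show "\<exists>C. \<forall>n. gnorm (unit_seq n) \<le> C" by (intro exI[of _ 1] allI gnorm_le unit_le)
  show "\<exists>g\<in>span (range unit_seq). gnorm (f - g) < e" if f: "f \<in> carrier" and e: "0 < e" for f e
  proof -
    obtain g where "g \<in> span (range unit_seq)" "\<forall>p\<in>P. p (f - g) \<le> e / 2"
      using f half_gt_zero[OF e] unfolding carrier_def by blast
    moreover from this have "gnorm (f - g) \<le> e / 2" by (intro gnorm_le) auto
    ultimately show ?thesis using e by (intro bexI[of _ g]) auto
  qed
  show "\<exists>C. \<forall>n. \<forall>f\<in>carrier. norm (f n) \<le> C * gnorm f"
    by (intro exI[of _ 1]) (simp add: coord_le_gnorm)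
  show "unit_seq k n = (if n = k then 1 else 0 :: 'k)" for n k by (simp add: unit_seq_def)
  show "(f + g) n = f n + g n" for f g :: "nat \<Rightarrow> 'k" and n by simp
  show "seq_scale c f n = c * f n" for c :: 'k and f n by (simp add: seq_scale_def)
qed

section \<open>Projections and a criterion for NULC\<close>

lemma lincomb_unit_seq:
  fixes c :: "nat \<Rightarrow> 'k"
  assumes "finite A"
  shows "(\<Sum>k\<in>A. seq_scale (c k) (unit_seq k)) = (\<lambda>n. if n \<in> A then c n else 0)"
  by (rule ext) (rule xs_lincomb[OF assms])

lemma proj_unit_seq: "finite A \<Longrightarrow> proj A f = (\<lambda>n. if n \<in> A then f n else 0)"
  unfolding proj_def by (rule lincomb_unit_seq)

lemma finite_support_in_carrier:
  assumes "finite A" "\<And>n. n \<notin> A \<Longrightarrow> f n = 0"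
  shows "f \<in> carrier"
proof -
  have "f = (\<Sum>k\<in>A. seq_scale (f k) (unit_seq k))"
    unfolding lincomb_unit_seq[OF assms(1)] using assms(2) by auto
  then show ?thesis using lincomb_in_X by metis
qed

text \<open>Reduces NULC to an estimate for each single gauge. The level set survives only as a
  finite set \<open>L\<close> carrying \<open>f\<close>, on which the moduli lie between
  \<open>t * s\<close> and \<open>s\<close>.\<close>

lemma nulc_gaugeI:
  fixes C :: "real \<Rightarrow> real"
  assumes pos: "\<And>t. 0 < t \<Longrightarrow> t \<le> 1 \<Longrightarrow> 0 < C t"
    and bound: "\<And>t s f L A p. \<lbrakk>0 < t; t \<le> 1; 0 < s; f \<in> carrier; finite L; p \<in> P;
      \<And>n. n \<in> L \<Longrightarrow> t * s \<le> norm (f n); \<And>n. norm (f n) \<le> s; \<And>n. n \<notin> L \<Longrightarrow> f n = 0\<rbrakk> \<Longrightarrow>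
      p (\<lambda>n. if n \<in> A then f n else 0) \<le> C t * gnorm f"
  shows nulc
  unfolding nulc_def
proof (rule allI, rule impI, rule_tac x="C t" in exI, intro allI impI conjI ballI)
  fix t :: real assume t: "0 < t \<and> t \<le> 1"
  then show "0 < C t" using pos by blast
  fix s f A
  assume s: "s > 0" and f: "f \<in> carrier" "f = proj (level_set f (t * s) s) f"
    and A: "A \<subseteq> level_set f (t * s) s"
  have ts: "t * s > 0" using t s by simp
  have fin: "finite (level_set f (t * s) s)" by (rule finite_level_set[OF f(1) ts])
  note supp = level_set_support[OF f ts]
  have ge: "t * s \<le> norm (f n)" if "n \<in> level_set f (t * s) s" for n
    using that by (simp add: level_set_def)
  have le: "norm (f n) \<le> s" for n
  proof (cases "n \<in> level_set f (t * s) s")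
    case False
    then show ?thesis using supp s by simp
  qed (simp add: level_set_def)
  show "gnorm (proj A f) \<le> C t * gnorm f"
    unfolding proj_unit_seq[OF finite_subset[OF A fin]]
  proof (rule gnorm_le)
    fix p assume "p \<in> P"
    then show "p (\<lambda>n. if n \<in> A then f n else 0) \<le> C t * gnorm f"
      by (rule bound[OF conjunct1[OF t] conjunct2[OF t] s f(1) fin _ ge le supp])
  qed
qed

end

section \<open>Spaces defined by a defect\<close>

definition coordinate_gauges :: "((nat \<Rightarrow> 'k::real_normed_field) \<Rightarrow> real) set" where
  "coordinate_gauges = range (\<lambda>n f. norm (f n))"

text \<open>The pair \<open>(a, b)\<close> is stored as \<open>a n = f (2 * n)\<close>, \<open>b j = f (2 * j + 1)\<close>.\<close>

definition defect ::
  "(nat \<Rightarrow> nat set) \<Rightarrow> (nat \<Rightarrow> real) \<Rightarrow> nat \<Rightarrow> (nat \<Rightarrow> 'k::real_normed_field) \<Rightarrow> 'k" where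
  "defect D w n f = f (2 * n) - of_real (w n) * (\<Sum>j\<in>D n. f (2 * j + 1))"

text \<open>Partial sums are used because they involve finitely many defects and so are continuous
  for coordinatewise convergence when the blocks are finite. Their supremum is the full
  \<open>l\<^sub>1\<close>-norm of the defect.\<close>

definition defect_gauges ::
  "(nat \<Rightarrow> nat set) \<Rightarrow> (nat \<Rightarrow> real) \<Rightarrow> ((nat \<Rightarrow> 'k::real_normed_field) \<Rightarrow> real) set" where
  "defect_gauges D w = range (\<lambda>m f. \<Sum>n<m. norm (defect D w n f))"

text \<open>The supremum over all finite nonempty \<open>B\<close> is the weak
  \<open>l\<^sub>1\<close> quasi-norm of the odd coordinates: a best set of size k consists of the k
  largest moduli, so its gauge is k times the k-th largest.\<close>

definition weak_l1_gauge :: "nat set \<Rightarrow> (nat \<Rightarrow> 'k::real_normed_field) \<Rightarrow> real" where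
  "weak_l1_gauge B f = card B * (MIN j\<in>B. norm (f (2 * j + 1)))"

definition weak_l1_gauges :: "((nat \<Rightarrow> 'k::real_normed_field) \<Rightarrow> real) set" where
  "weak_l1_gauges = {weak_l1_gauge B | B. finite B \<and> B \<noteq> {}}"

section \<open>The three gauge families\<close>

lemma gauge_family_coordinate:
  assumes "1 \<le> \<kappa>"
  shows "gauge_family \<kappa> coordinate_gauges"
  by (rule gauge_family_seminorms[OF assms])
    (auto simp: coordinate_gauges_def seq_scale_def norm_mult unit_seq_def norm_triangle_ineq
      intro: tendsto_norm)

lemma norm_defect_unit_seq_even:
  "norm (defect D w n (unit_seq (2 * i))) = (if n = i then 1 else 0)"
proof -
  have "2 * j + 1 \<noteq> 2 * i" for j :: nat by presburger
  then show ?thesis by (simp add: defect_def unit_seq_def)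
qed

lemma norm_defect_unit_seq_odd:
  assumes "finite (D n)" "0 \<le> w n"
  shows "norm (defect D w n (unit_seq (2 * i + 1))) = (if i \<in> D n then w n else 0)"
proof -
  have "2 * n \<noteq> Suc (2 * i)" by presburger
  then show ?thesis using assms
    by (simp add: defect_def unit_seq_def if_distrib sum.delta cong: if_cong)
qed

text \<open>The gauges are seminorms, being finite sums of moduli of linear functionals.
  Disjointness of the blocks matters for the unit vectors: each meets at most one defect, with
  weight at most 1.\<close>

lemma gauge_family_defect:
  assumes "1 \<le> \<kappa>" and D: "\<And>n. finite (D n)" "\<And>i n m. \<lbrakk>i \<in> D n; i \<in> D m\<rbrakk> \<Longrightarrow> n = m"
    and w: "\<And>n. 0 \<le> w n" "\<And>n. w n \<le> 1"
  shows "gauge_family \<kappa> (defect_gauges D w)"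
proof (rule gauge_family_seminorms[OF assms(1)])
  fix p :: "(nat \<Rightarrow> 'a) \<Rightarrow> real" assume "p \<in> defect_gauges D w"
  then obtain m where p: "p = (\<lambda>f. \<Sum>n<m. norm (defect D w n f))"
    by (auto simp: defect_gauges_def)
  show "0 \<le> p f" for f by (simp add: p sum_nonneg)
  show "p (seq_scale c f) = norm c * p f" for c f
  proof -
    have "defect D w n (seq_scale c f) = c * defect D w n f" for n
      by (simp add: defect_def seq_scale_def algebra_simps sum_distrib_left)
    then show ?thesis by (simp add: p norm_mult sum_distrib_left)
  qed
  show "p (f + g) \<le> p f + p g" for f g
  proof -
    have "defect D w n (f + g) = defect D w n f + defect D w n g" for n
      by (simp add: defect_def algebra_simps sum.distrib)
    then show ?thesis by (simp add: p flip: sum.distrib) (intro sum_mono norm_triangle_ineq)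
  qed
  show "(\<lambda>k. p (u k)) \<longlonglongrightarrow> p f" if "\<forall>n. (\<lambda>k. u k n) \<longlonglongrightarrow> f n" for u f
    unfolding p defect_def using that by (intro tendsto_intros) auto
  show "p (unit_seq k) \<le> 1" for k
  proof (cases "even k")
    case True
    then obtain i where "k = 2 * i" by blast
    then show ?thesis by (simp add: p norm_defect_unit_seq_even)
  next
    case False
    then obtain i where k: "k = 2 * i + 1" using oddE by blast
    have "p (unit_seq k) = (\<Sum>n<m. if i \<in> D n then w n else 0)"
      unfolding p k by (simp only: norm_defect_unit_seq_odd[OF D(1) w(1)])
    also have "\<dots> \<le> 1"
    proof (cases "\<exists>l<m. i \<in> D l")
      case True
      then obtain l where l: "l < m" "i \<in> D l" by blast
      then have "(\<Sum>n<m. if i \<in> D n then w n else 0) = (\<Sum>n<m. if n = l then w n else 0)"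
        using D(2) by (intro sum.cong) auto
      then show ?thesis using w(2) l by simp
    next
      case False
      then have "(\<Sum>n<m. if i \<in> D n then w n else 0) = 0" by (intro sum.neutral) auto
      then show ?thesis by simp
    qed
    finally show ?thesis .
  qed
qed

lemma weak_l1_gauge_ge:
  fixes c :: real
  assumes "finite B" "\<And>j. j \<in> B \<Longrightarrow> c \<le> norm (f (2 * j + 1))"
  shows "card B * c \<le> weak_l1_gauge B f"
\<comment> \<open>For empty \<open>B\<close> the minimum is a junk value, but its factor
  \<open>card B\<close> is 0.\<close>
proof (cases "B = {}")
  case False
  then have "c \<le> (MIN j\<in>B. norm (f (2 * j + 1)))" using assms by auto
  then show ?thesis by (auto simp: weak_l1_gauge_def intro: mult_left_mono)
qed (simp add: weak_l1_gauge_def)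

lemma weak_l1_gauge_le:
  assumes "finite B" "j \<in> B"
  shows "weak_l1_gauge B f \<le> card B * norm (f (2 * j + 1))"
  unfolding weak_l1_gauge_def using assms by (intro mult_left_mono) (auto intro: Min_le)

text \<open>Used when \<open>f\<close> is a truncation of \<open>g\<close>: truncating does not
  increase the weak gauges.\<close>

lemma weak_l1_gauge_mono:
  assumes "finite B" "B \<noteq> {}" "\<And>j. j \<in> B \<Longrightarrow> norm (f (2 * j + 1)) \<le> norm (g (2 * j + 1))"
  shows "weak_l1_gauge B f \<le> weak_l1_gauge B g"
proof -
  have "(MIN j\<in>B. norm (f (2 * j + 1))) \<le> norm (g (2 * j + 1))" if "j \<in> B" for j
    using assms that by (meson Min_le finite_imageI image_eqI order_trans)
  then have "(MIN j\<in>B. norm (f (2 * j + 1))) \<le> (MIN j\<in>B. norm (g (2 * j + 1)))"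
    using assms by auto
  then show ?thesis by (auto simp: weak_l1_gauge_def intro: mult_left_mono)
qed

lemma weak_l1_gauge_nonneg: "finite B \<Longrightarrow> 0 \<le> weak_l1_gauge B f"
  using weak_l1_gauge_ge[of B 0 f] by simp

text \<open>At each index of \<open>B\<close> one summand is at least half of \<open>f + g\<close>, so one of the two is on half
  of the indices.\<close>

lemma weak_l1_gauge_split:
  fixes f g :: "nat \<Rightarrow> 'k::real_normed_field"
  assumes B: "finite B" and C: "C \<subseteq> B" "card B \<le> 2 * card C" "C \<noteq> {}"
    and le: "\<And>j. j \<in> C \<Longrightarrow> norm (g (2 * j + 1)) \<le> 2 * norm (f (2 * j + 1))"
  shows "weak_l1_gauge B g \<le> 4 * weak_l1_gauge C f"
proof -
  let ?m = "MIN j\<in>B. norm (g (2 * j + 1))"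
  have m: "?m \<le> norm (g (2 * j + 1))" if "j \<in> C" for j using that B C by (auto intro: Min_le)
  have "0 \<le> ?m" using B C by (subst Min_ge_iff) auto
  then have "card B * ?m \<le> (2 * card C) * ?m" using C by (intro mult_right_mono) linarith+
  \<comment> \<open>One factor 2 comes from the cardinalities, the other from the comparison of the
    moduli.\<close>
  also have "\<dots> = 4 * (card C * (?m / 2))" by simp
  also have "card C * (?m / 2) \<le> weak_l1_gauge C f"
  proof (rule weak_l1_gauge_ge)
    show "finite C" using B C finite_subset by blast
    show "?m / 2 \<le> norm (f (2 * j + 1))" if "j \<in> C" for j
      using m[OF that] le[OF that] by simp
  qed
  finally show ?thesis by (simp add: weak_l1_gauge_def[of B])
qed

lemma tendsto_MIN:
  fixes F :: "'a \<Rightarrow> 'b \<Rightarrow> 'c::linorder_topology"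
  assumes "finite B" "B \<noteq> {}" "\<And>j. j \<in> B \<Longrightarrow> ((\<lambda>x. F j x) \<longlongrightarrow> l j) \<A>"
  shows "((\<lambda>x. MIN j\<in>B. F j x) \<longlongrightarrow> (MIN j\<in>B. l j)) \<A>"
  using assms by (induction B rule: finite_ne_induct) (auto intro: tendsto_min)

lemma gauge_family_weak_l1: "gauge_family 4 weak_l1_gauges"
  unfolding gauge_family_def
proof (intro ballI conjI allI impI)
  fix p :: "(nat \<Rightarrow> 'a) \<Rightarrow> real" assume "p \<in> weak_l1_gauges"
  then obtain B where p: "p = weak_l1_gauge B" and B: "finite B" "B \<noteq> {}"
    by (auto simp: weak_l1_gauges_def)
  show "0 \<le> p f" for f unfolding p by (rule weak_l1_gauge_nonneg[OF B(1)])
  show "p (seq_scale c f) = norm c * p f" for c f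
  proof -
    have "(MIN j\<in>B. norm c * norm (f (2 * j + 1))) = norm c * (MIN j\<in>B. norm (f (2 * j + 1)))"
      using B hom_Min_commute[of "(*) (norm c)" "(\<lambda>j. norm (f (2 * j + 1))) ` B"]
      by (simp add: image_image min_mult_distrib_left)
    then show ?thesis by (simp add: p weak_l1_gauge_def seq_scale_def norm_mult)
  qed
  show "\<exists>q\<in>weak_l1_gauges. \<exists>r\<in>weak_l1_gauges. p (f + g) \<le> 4 * (q f + r g)" for f g
  proof -
    \<comment> \<open>On \<open>C\<close> the summand \<open>f\<close> has at least half the modulus
      of \<open>f + g\<close>; off \<open>C\<close> the triangle inequality gives this for
      \<open>g\<close>. The larger of the two parts contains at least half of
      \<open>B\<close>.\<close>
    define C where "C = {j \<in> B. norm ((f + g) (2 * j + 1)) \<le> 2 * norm (f (2 * j + 1))}"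
    have fin: "finite C" "finite (B - C)" using B by (auto simp: C_def)
    have card: "card B = card C + card (B - C)"
      using B card_Un_disjoint[of C "B - C"] by (auto simp: C_def Un_absorb1)
    have in_fam: "weak_l1_gauge C' \<in> weak_l1_gauges" if "C' \<noteq> {}" "finite C'" for C'
      using that by (auto simp: weak_l1_gauges_def)
    have B_fam: "weak_l1_gauge B \<in> weak_l1_gauges" using B in_fam by blast
    have cB: "card B > 0" using B by (simp add: card_gt_0_iff)
    show ?thesis
    proof (cases "card B \<le> 2 * card C")
      case True
      then have ne: "C \<noteq> {}" using cB by auto
      have "p (f + g) \<le> 4 * weak_l1_gauge C f"
        unfolding p by (rule weak_l1_gauge_split[OF B(1) _ True ne]) (auto simp: C_def)
      \<comment> \<open>The family condition asks for a gauge of \<open>g\<close> as well; any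
        nonnegative term will do.\<close>
      then have "p (f + g) \<le> 4 * (weak_l1_gauge C f + weak_l1_gauge B g)"
        using weak_l1_gauge_nonneg[OF B(1), of g] by simp
      then show ?thesis using in_fam[OF ne fin(1)] B_fam by blast
    next
      case False
      then have le: "card B \<le> 2 * card (B - C)" and "card (B - C) > 0"
        using card by linarith+
      then have ne: "B - C \<noteq> {}" by (metis card.empty less_irrefl)
      have "norm ((f + g) (2 * j + 1)) \<le> 2 * norm (g (2 * j + 1))" if "j \<in> B - C" for j
        using that norm_triangle_ineq[of "f (2 * j + 1)" "g (2 * j + 1)"] by (auto simp: C_def)
      then have "p (f + g) \<le> 4 * weak_l1_gauge (B - C) g"
        unfolding p by (intro weak_l1_gauge_split[OF B(1) _ le ne]) auto
      then have "p (f + g) \<le> 4 * (weak_l1_gauge B f + weak_l1_gauge (B - C) g)"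
        using weak_l1_gauge_nonneg[OF B(1), of f] by simp
      then show ?thesis using in_fam[OF ne fin(2)] B_fam by blast
    qed
  qed
  show "(\<lambda>k. p (u k)) \<longlonglongrightarrow> p f" if "\<forall>n. (\<lambda>k. u k n) \<longlonglongrightarrow> f n" for u f
    unfolding p weak_l1_gauge_def using that
    by (intro tendsto_mult tendsto_const tendsto_MIN B tendsto_norm) auto
  show "p (unit_seq k) \<le> 1" for k
  \<comment> \<open>An index of \<open>B\<close> other than the one stored at \<open>k\<close>
    forces the minimum to be 0. Otherwise \<open>B\<close> is a singleton and the gauge is
    1.\<close>
  proof (cases "\<exists>j\<in>B. k \<noteq> 2 * j + 1")
    case True
    then obtain j where j: "j \<in> B" "k \<noteq> 2 * j + 1" by blast
    then show ?thesis using weak_l1_gauge_le[OF B(1) j(1), of "unit_seq k :: nat \<Rightarrow> 'a"]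
      by (simp add: p unit_seq_def split: if_splits)
  next
    case False
    then obtain j where j: "B = {j}"
      using B by (metis add_right_cancel mult_cancel1 numeral_neq_zero is_singletonI' is_singletonE zero_neq_numeral)
    show ?thesis by (simp add: p j weak_l1_gauge_def unit_seq_def)
  qed
qed

lemma gauge_space_defect:
  assumes "1 \<le> \<kappa>" and D: "\<And>n. finite (D n)" "\<And>i n m. \<lbrakk>i \<in> D n; i \<in> D m\<rbrakk> \<Longrightarrow> n = m"
    and w: "\<And>n. 0 \<le> w n" "\<And>n. w n \<le> 1"
    and Q: "gauge_family \<kappa> Q"
  shows "gauge_space (coordinate_gauges \<union> defect_gauges D w \<union> Q) \<kappa>"
  unfolding gauge_space_def gauge_space_axioms_def
  by (intro conjI vector_space_seq_scale gauge_family_Un gauge_family_coordinate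
      gauge_family_defect assms) (auto simp: coordinate_gauges_def)

text \<open>If the block misses \<open>L\<close>, its sum is 0 before and after truncation, and the
  defect can only shrink. Otherwise the count is at least 1, so the even coefficient and the block
  sum are each at most \<open>s\<close> times the count.\<close>

lemma norm_defect_restrict_le_of_flat:
  fixes f :: "nat \<Rightarrow> 'k::real_normed_field"
  assumes s: "\<And>n. norm (f n) \<le> s" and L: "\<And>n. n \<notin> L \<Longrightarrow> f n = 0"
    and fin: "finite (D n)" and w: "w n = 1"
  shows "norm (defect D w n (\<lambda>k. if k \<in> A then f k else 0))
    \<le> norm (defect D w n f) + 2 * s * card {j \<in> D n. 2 * j + 1 \<in> L}"
proof (cases "{j \<in> D n. 2 * j + 1 \<in> L} = {}")
  case True
  then have "f (2 * j + 1) = 0" if "j \<in> D n" for j using L that by blast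
  then show ?thesis unfolding True by (simp add: defect_def w sum.neutral)
next
  case False
  let ?J = "{j \<in> D n. 2 * j + 1 \<in> L}" and ?f = "\<lambda>k. if k \<in> A then f k else 0"
  have s0: "0 \<le> s" using s[of 0] norm_ge_zero order_trans by blast
  have f: "norm (?f k) \<le> s" for k using s s0 by simp
  have "card ?J > 0" using False fin by (simp add: card_gt_0_iff)
  then have "1 \<le> real (card ?J)" by linarith
  then have "s * 1 \<le> s * card ?J" by (rule mult_left_mono[OF _ s0])
  moreover have "norm (\<Sum>j\<in>D n. ?f (2 * j + 1)) \<le> s * card ?J"
  proof -
    have "(\<Sum>j\<in>D n. ?f (2 * j + 1)) = (\<Sum>j\<in>?J. ?f (2 * j + 1))"
      by (rule sum.mono_neutral_right) (use fin L in auto)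
    also have "norm \<dots> \<le> (\<Sum>j\<in>?J. s)" by (intro sum_norm_le f)
    finally show ?thesis by (simp add: mult.commute)
  qed
  moreover have "norm (defect D w n ?f) \<le> norm (?f (2 * n)) + norm (\<Sum>j\<in>D n. ?f (2 * j + 1))"
    unfolding defect_def w by (simp only: of_real_1 mult_1 norm_triangle_ineq4)
  ultimately have "norm (defect D w n ?f) \<le> 2 * s * card ?J" using f[of "2 * n"] by linarith
  then show ?thesis by (simp add: add_increasing)
qed

text \<open>If the even coefficient vanishes, truncation only shrinks the defect. If not, it is at
  least \<open>t * s\<close> against a correction of at most \<open>t / 2 * s\<close>, so the defect
  of \<open>f\<close> is at least \<open>t / 2 * s\<close>, while the truncated one is at most
  \<open>2 * s\<close>; the quotient is \<open>4 / t\<close>.\<close>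

lemma norm_defect_restrict_le_of_small:
  fixes f :: "nat \<Rightarrow> 'k::real_normed_field"
  assumes t: "0 < t" "t \<le> 1" and s: "\<And>k. norm (f k) \<le> s"
    and flat: "f (2 * n) = 0 \<or> t * s \<le> norm (f (2 * n))"
    and D: "D n = {n}" and w: "0 \<le> w n" "w n \<le> t / 2"
  shows "norm (defect D w n (\<lambda>k. if k \<in> A then f k else 0)) \<le> 4 / t * norm (defect D w n f)"
proof -
  let ?a = "f (2 * n)" and ?b = "f (2 * n + 1)" and ?f = "\<lambda>k. if k \<in> A then f k else 0"
  have s0: "0 \<le> s" using s[of 0] norm_ge_zero order_trans by blast
  have eq: "defect D w n g = g (2 * n) - of_real (w n) * g (2 * n + 1)" for g :: "nat \<Rightarrow> 'k"
    by (simp add: defect_def D)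
  have wb: "norm (of_real (w n) * ?b) \<le> t / 2 * s"
    unfolding norm_mult using w s[of "2 * n + 1"] t by (intro mult_mono) auto
  have t4: "1 \<le> 4 / t" using t by (simp add: field_simps)
  show ?thesis
  proof (cases "?a = 0")
    case True
    have "norm (defect D w n ?f) \<le> norm (defect D w n f)"
      unfolding eq using True by (simp add: norm_mult)
    also have "\<dots> \<le> 4 / t * norm (defect D w n f)"
      using mult_right_mono[OF t4 norm_ge_zero[of "defect D w n f"]] by simp
    finally show ?thesis .
  next
    case False
    have "norm ?a \<le> norm (?a - of_real (w n) * ?b) + norm (of_real (w n) * ?b)"
      using norm_triangle_sub by (metis add.commute)
    then have "t / 2 * s \<le> norm (?a - of_real (w n) * ?b)" using flat False wb by linarith
    then have ge: "2 * s \<le> 4 / t * norm (?a - of_real (w n) * ?b)" using t by (simp add: field_simps)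
    have "norm (defect D w n ?f) \<le> norm (?f (2 * n)) + norm (of_real (w n) * ?f (2 * n + 1))"
      unfolding eq by (rule norm_triangle_ineq4)
    also have "\<dots> \<le> s + t / 2 * s" using s[of "2 * n"] s0 wb t by (intro add_mono) auto
    also have "\<dots> \<le> 2 * s" using t s0 mult_right_mono[of "t / 2" 1 s] by simp
    finally show ?thesis using ge by (simp add: eq)
  qed
qed

section \<open>Dyadic blocks and the harmonic sequence\<close>

definition dyadic :: "nat \<Rightarrow> nat set" where
  "dyadic n = {2 ^ n..<2 ^ Suc n}"

lemma finite_dyadic: "finite (dyadic n)"
  by (simp add: dyadic_def)

lemma dyadic_disjoint:
  assumes "i \<in> dyadic n" "i \<in> dyadic m"
  shows "n = m"
proof -
  have "(2::nat) ^ n < 2 ^ Suc m" "(2::nat) ^ m < 2 ^ Suc n"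
    using assms unfolding dyadic_def atLeastLessThan_iff by linarith+
  then have "n < Suc m" "m < Suc n"
    using power_less_imp_less_exp[of "2::nat"] one_less_numeral_iff semiring_norm(76) by blast+
  then show ?thesis by simp
qed

text \<open>The block has \<open>2 ^ n\<close> terms, each between \<open>1 / 2 ^ Suc n\<close> and
  \<open>1 / 2 ^ n\<close>.\<close>

lemma sum_inverse_dyadic:
  "1 / 2 \<le> (\<Sum>j\<in>dyadic n. 1 / real j)" "(\<Sum>j\<in>dyadic n. 1 / real j) \<le> 1"
proof -
  have pos: "0 < j" if "j \<in> dyadic n" for j
    using that by (auto simp: dyadic_def intro: less_le_trans[of 0 "2 ^ n"])
  have j: "2 ^ n \<le> real j" "real j \<le> 2 ^ Suc n" if "j \<in> dyadic n" for j
    using that by (auto simp: dyadic_def simp flip: of_nat_power of_nat_le_iff simp del: power_Suc)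
  have card: "card (dyadic n) = 2 ^ n" by (simp add: dyadic_def)
  have "(\<Sum>j\<in>dyadic n. 1 / 2 ^ Suc n) \<le> (\<Sum>j\<in>dyadic n. 1 / real j)"
    using j by (intro sum_mono divide_left_mono) (auto simp: pos simp del: power_Suc intro!: mult_pos_pos)
  then show "1 / 2 \<le> (\<Sum>j\<in>dyadic n. 1 / real j)" by (simp add: card)
  have "(\<Sum>j\<in>dyadic n. 1 / real j) \<le> (\<Sum>j\<in>dyadic n. 1 / 2 ^ n)"
    using j by (intro sum_mono divide_left_mono) (auto simp: pos simp del: power_Suc intro!: mult_pos_pos)
  then show "(\<Sum>j\<in>dyadic n. 1 / real j) \<le> 1" by (simp add: card)
qed

section \<open>The two examples\<close>

lemma finite_odd_support: "finite L \<Longrightarrow> finite {j. 2 * j + 1 \<in> (L :: nat set)}"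
  using finite_vimageI[of L "\<lambda>j. 2 * j + 1"] by (simp add: vimage_def inj_on_def)

lemma ex_nulc_not_nearly_unconditional:
  "\<exists>(X :: (nat \<Rightarrow> 'k::{real_normed_field,banach}) set) qnorm x xs.
    quasi_banach_basis seq_scale X qnorm x xs \<and>
    quasi_banach_basis.nulc seq_scale X qnorm x xs \<and>
    \<not> quasi_banach_basis.nearly_unconditional seq_scale X qnorm x xs"
proof -
  define P :: "((nat \<Rightarrow> 'k) \<Rightarrow> real) set"
    where "P = coordinate_gauges \<union> defect_gauges dyadic (\<lambda>_. 1) \<union> weak_l1_gauges"
  interpret gauge_space P 4
    unfolding P_def
    by (rule gauge_space_defect)
      (simp_all add: gauge_family_weak_l1 finite_dyadic dyadic_disjoint)
  have defectP: "(\<lambda>f. \<Sum>n<m. norm (defect dyadic (\<lambda>_. 1) n f)) \<in> P" for m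
    by (auto simp: P_def defect_gauges_def)
  have weakP: "weak_l1_gauge B \<in> P" if "finite B" "B \<noteq> {}" for B
    using that by (auto simp: P_def weak_l1_gauges_def)
  have casesP [consumes 1, case_names coordinate defect weak]: thesis if "p \<in> P"
    "\<And>n. p = (\<lambda>f. norm (f n)) \<Longrightarrow> thesis"
    "\<And>m. p = (\<lambda>f. \<Sum>n<m. norm (defect dyadic (\<lambda>_. 1) n f)) \<Longrightarrow> thesis"
    "\<And>B. p = weak_l1_gauge B \<Longrightarrow> finite B \<Longrightarrow> B \<noteq> {} \<Longrightarrow> thesis" for p thesis
    using that unfolding P_def coordinate_gauges_def defect_gauges_def weak_l1_gauges_def by blast

  \<comment> \<open>The 1 pays for the gauge of \<open>f\<close> itself, and \<open>2 / t\<close>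
    for the error that truncation causes in the defects.\<close>
  have nulc
  proof (rule nulc_gaugeI[where C = "\<lambda>t. 1 + 2 / t"])
    show "0 < 1 + 2 / t" if "0 < t" for t :: real using that by (simp add: add_pos_pos)
    fix t s :: real and f :: "nat \<Rightarrow> 'k" and L A p
    assume t: "0 < t" "t \<le> 1" and s: "0 < s" and f: "f \<in> carrier" and L: "finite L" and p: "p \<in> P"
      and ge: "\<And>n. n \<in> L \<Longrightarrow> t * s \<le> norm (f n)" and le: "\<And>n. norm (f n) \<le> s"
      and supp: "\<And>n. n \<notin> L \<Longrightarrow> f n = 0"
    let ?f = "\<lambda>n. if n \<in> A then f n else 0"
    have g0: "0 \<le> gnorm f" by (rule gnorm_nonneg[OF f])
    have mono: "x \<le> (1 + 2 / t) * gnorm f" if "x \<le> gnorm f" for x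
      using that g0 t mult_right_mono[of 1 "1 + 2 / t" "gnorm f"] by simp
    from p show "p ?f \<le> (1 + 2 / t) * gnorm f"
    proof (cases rule: casesP)
      case (coordinate n)
      have "norm (?f n) \<le> gnorm f" using coord_le_gnorm[OF f, of n] g0 by simp
      then show ?thesis unfolding coordinate by (rule mono)
    next
      case (defect m)
      define B where "B = {j. 2 * j + 1 \<in> L}"
      have B: "finite B" unfolding B_def by (rule finite_odd_support[OF L])
      \<comment> \<open>Every odd coefficient indexed by \<open>B\<close> has modulus at least
        \<open>t * s\<close>, so the weak gauge of \<open>B\<close> bounds their number.\<close>
      have "card B * (t * s) \<le> gnorm f"
      proof (cases "B = {}")
        case False
        have "card B * (t * s) \<le> weak_l1_gauge B f"
          by (rule weak_l1_gauge_ge[OF B]) (use ge in \<open>auto simp: B_def\<close>)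
        also have "\<dots> \<le> gnorm f" by (rule gauge_le_gnorm[OF f weakP[OF B False]])
        finally show ?thesis .
      qed (simp add: g0)
      then have cB: "2 * s * card B \<le> 2 / t * gnorm f" using t by (simp add: field_simps)
      let ?J = "\<lambda>n. {j \<in> dyadic n. 2 * j + 1 \<in> L}"
      \<comment> \<open>The blocks are disjoint, so the errors in all defects together count each
        index of \<open>B\<close> at most once.\<close>
      have "(\<Sum>n<m. card (?J n)) = card (\<Union>n<m. ?J n)"
        by (rule card_UN_disjoint[symmetric]) (auto simp: finite_dyadic dest: dyadic_disjoint)
      also have "\<dots> \<le> card B" by (rule card_mono[OF B]) (auto simp: B_def)
      finally have J: "(\<Sum>n<m. real (card (?J n))) \<le> card B" by (simp flip: of_nat_sum)
      have "p ?f \<le> (\<Sum>n<m. norm (defect dyadic (\<lambda>_. 1) n f) + 2 * s * card (?J n))"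
        unfolding defect by (intro sum_mono norm_defect_restrict_le_of_flat le supp finite_dyadic) auto
      also have "\<dots> = (\<Sum>n<m. norm (defect dyadic (\<lambda>_. 1) n f)) + 2 * s * (\<Sum>n<m. real (card (?J n)))"
        by (simp add: sum.distrib sum_distrib_left)
      also have "\<dots> \<le> gnorm f + 2 * s * card B"
        using s by (intro add_mono mult_left_mono J gauge_le_gnorm[OF f defectP]) auto
      also have "\<dots> \<le> (1 + 2 / t) * gnorm f" using cB by (simp add: distrib_right)
      finally show ?thesis .
    next
      case (weak B)
      have "weak_l1_gauge B ?f \<le> weak_l1_gauge B f" by (rule weak_l1_gauge_mono[OF weak(2,3)]) simp
      also have "\<dots> \<le> gnorm f" by (rule gauge_le_gnorm[OF f weakP[OF weak(2,3)]])
      finally show ?thesis unfolding weak(1) by (rule mono)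
    qed
  qed
  moreover have "\<not> nearly_unconditional"
  proof
    assume nu: nearly_unconditional
    \<comment> \<open>The values \<open>t = 1 / 2\<close> and \<open>s = 1\<close> fit the even
      coefficients chosen below, which lie between 1/2 and 1.\<close>
    have half: "0 < (1 / 2 :: real) \<and> 1 / 2 \<le> (1 :: real)" by simp
    obtain C where C: "\<forall>f\<in>carrier. \<forall>s>0. coef_sup f \<le> s \<longrightarrow>
        (\<forall>A \<subseteq> level_set f (1 / 2 * s) s. gnorm (proj A f) \<le> C * gnorm f)" and "C > 0"
      using mp[OF spec[OF nu[unfolded nearly_unconditional_def]] half] by blast
    \<comment> \<open>The projection will have norm at least \<open>N / 2\<close>, and
      \<open>f\<close> norm at most 1.\<close>
    obtain N :: nat where N: "2 * C < N" using reals_Archimedean2 by blast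
    define a where "a n = (if n < N then \<Sum>j\<in>dyadic n. 1 / real j else 0)" for n
    \<comment> \<open>The cut at \<open>2 ^ N\<close> keeps exactly the first \<open>N\<close>
      blocks, so no block is split. Index 0 lies in no block, and \<open>b 0 = 0\<close> since
      \<open>1 / 0 = 0\<close>.\<close>
    define b where "b j = (if j < 2 ^ N then 1 / real j else 0)" for j
    define f :: "nat \<Rightarrow> 'k" where "f k = of_real (if even k then a (k div 2) else b (k div 2))" for k
    have f_even: "f (2 * n) = of_real (a n)" and f_odd: "f (2 * j + 1) = of_real (b j)" for n j
      by (simp_all add: f_def)
    have a: "0 \<le> a n" "a n \<le> 1" "n < N \<Longrightarrow> 1 / 2 \<le> a n" for n
      using sum_inverse_dyadic[of n] by (auto simp: a_def intro: sum_nonneg)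
    have b: "0 \<le> b j" "b j \<le> 1" for j by (auto simp: b_def divide_le_eq_1)
    have f_le: "norm (f k) \<le> 1" for k using a b by (simp add: f_def)
    have f_carrier: "f \<in> carrier"
    proof (rule finite_support_in_carrier)
      show "finite {..2 * 2 ^ N :: nat}" by simp
      fix k :: nat assume "k \<notin> {..2 * 2 ^ N}"
      then have "2 ^ N \<le> k div 2" by (simp add: less_eq_div_iff_mult_less_eq)
      moreover from this have "N \<le> k div 2" using less_exp[of N] by linarith
      ultimately show "f k = 0" by (simp add: f_def a_def b_def)
    qed
    have "coef_sup f \<le> 1" unfolding coef_sup_def by (rule cSUP_least) (use f_le in auto)
    moreover define A where "A = (\<lambda>n. 2 * n) ` {..<N}"
    have "A \<subseteq> level_set f (1 / 2 * 1) 1"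
      using a by (auto simp: A_def level_set_def f_even simp del: of_real_add)
    ultimately have "gnorm (proj A f) \<le> C * gnorm f" using C f_carrier zero_less_one by blast
    also have "\<dots> \<le> C * 1"
    proof (rule mult_left_mono)
      show "gnorm f \<le> 1"
      proof (rule gnorm_le)
        fix p assume "p \<in> P"
        then show "p f \<le> 1"
        proof (cases rule: casesP)
          case (coordinate n)
          then show ?thesis using f_le by simp
        next
          case (defect m)
          have "defect dyadic (\<lambda>_. 1) n f = 0" for n
          proof -
            have "(\<Sum>j\<in>dyadic n. b j) = a n"
            proof (cases "n < N")
              case True
              then have "(2::nat) ^ Suc n \<le> 2 ^ N" by (intro power_increasing) auto
              then have "j < 2 ^ N" if "j \<in> dyadic n" for j
                using that unfolding dyadic_def atLeastLessThan_iff by linarith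
              then show ?thesis using True by (simp add: a_def b_def)
            next
              case False
              then have "(2::nat) ^ N \<le> 2 ^ n" by (intro power_increasing) auto
              then have "\<not> j < 2 ^ N" if "j \<in> dyadic n" for j
                using that unfolding dyadic_def atLeastLessThan_iff by linarith
              then show ?thesis using False by (simp add: a_def b_def)
            qed
            then show ?thesis unfolding defect_def f_even f_odd by (simp flip: of_real_sum)
          qed
          then show ?thesis using defect by simp
        next
          case (weak B)
          show ?thesis
          \<comment> \<open>If 0 is in \<open>B\<close>, the minimum is 0. Otherwise
            \<open>B\<close> has at most \<open>Max B\<close> elements, while the coefficient at
            \<open>Max B\<close> is at most \<open>1 / Max B\<close>.\<close>
          proof (cases "0 \<in> B")
            case True
            then show ?thesis
              using weak_l1_gauge_le[OF weak(2) True, of f] f_odd[of 0] by (simp add: weak(1) b_def)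
          next
            case False
            have M: "Max B \<in> B" using weak by simp
            have "B \<subseteq> {1..Max B}"
            proof
              fix j assume j: "j \<in> B"
              then have "j \<noteq> 0" using False by metis
              then show "j \<in> {1..Max B}" using Max_ge[OF weak(2) j] by simp
            qed
            then have "card B \<le> card {1..Max B}" by (rule card_mono[rotated]) simp
            then have card: "real (card B) \<le> Max B" by simp
            have "p f \<le> card B * norm (f (2 * Max B + 1))"
              unfolding weak(1) by (rule weak_l1_gauge_le[OF weak(2) M])
            also have "\<dots> \<le> card B * (1 / Max B)"
              unfolding f_odd by (rule mult_left_mono) (auto simp: b_def)
            also have "\<dots> \<le> 1" using card by (simp add: divide_le_eq_1 neq0_conv[symmetric] del: neq0_conv)
            finally show ?thesis .
          qed
        qed
      qed
    qed (use \<open>C > 0\<close> in simp)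
    finally have le_C: "gnorm (proj A f) \<le> C" by simp
    have fin: "finite A" by (simp add: A_def)
    have "real N / 2 = (\<Sum>n<N. 1 / 2)" by simp
    also have "\<dots> \<le> (\<Sum>n<N. norm (defect dyadic (\<lambda>_. 1) n (proj A f)))"
    proof (rule sum_mono)
      fix n assume n: "n \<in> {..<N}"
      \<comment> \<open>The projection removes all odd coordinates, so nothing cancels the even ones
        any more.\<close>
      have "2 * j + 1 \<notin> A" for j unfolding A_def by (auto, presburger)
      then have "defect dyadic (\<lambda>_. 1) n (proj A f) = f (2 * n)"
        using n unfolding proj_unit_seq[OF fin] defect_def by (simp add: A_def)
      then show "1 / 2 \<le> norm (defect dyadic (\<lambda>_. 1) n (proj A f))" using a n by (simp add: f_even)
    qed
    also have "\<dots> \<le> gnorm (proj A f)"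
    proof (rule gauge_le_gnorm[OF _ defectP])
      show "proj A f \<in> carrier" unfolding proj_def by (rule lincomb_in_X)
    qed
    finally show False using le_C N by simp
  qed
  ultimately show ?thesis using quasi_banach_basis_axioms by blast
qed

lemma ex_nulc_not_lpu:
  "\<exists>(X :: (nat \<Rightarrow> 'k::{real_normed_field,banach}) set) qnorm x xs.
    quasi_banach_basis seq_scale X qnorm x xs \<and>
    quasi_banach_basis.nulc seq_scale X qnorm x xs \<and>
    \<not> quasi_banach_basis.lpu seq_scale qnorm x"
proof -
  define D :: "nat \<Rightarrow> nat set" where "D n = {n}" for n
  define w where "w n = 1 / sqrt (real n + 1)" for n
  have w: "0 \<le> w n" "w n \<le> 1" for n by (auto simp: w_def)
  \<comment> \<open>All gauges are now seminorms, so the constant 1 is available and the example is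
    a Banach space.\<close>
  define P :: "((nat \<Rightarrow> 'k) \<Rightarrow> real) set"
    where "P = coordinate_gauges \<union> defect_gauges D w \<union> {}"
  interpret gauge_space P 1
    unfolding P_def by (rule gauge_space_defect) (auto simp: gauge_family_def D_def w)
  have defectP: "(\<lambda>f. \<Sum>n<m. norm (defect D w n f)) \<in> P" for m
    by (auto simp: P_def defect_gauges_def)
  have casesP [consumes 1, case_names coordinate defect]: thesis if "p \<in> P"
    "\<And>n. p = (\<lambda>f. norm (f n)) \<Longrightarrow> thesis"
    "\<And>m. p = (\<lambda>f. \<Sum>n<m. norm (defect D w n f)) \<Longrightarrow> thesis" for p thesis
    using that unfolding P_def coordinate_gauges_def defect_gauges_def by blast
  have defect_eq: "defect D w n f = f (2 * n) - of_real (w n) * f (2 * n + 1)" for n and f :: "nat \<Rightarrow> 'k"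
    by (simp add: defect_def D_def)

  \<comment> \<open>Solves \<open>sqrt (n + 1) \<ge> 2 / t\<close>, the point from which
    \<open>w n \<le> t / 2\<close>.\<close>
  define M where "M t = nat \<lceil>4 / t\<^sup>2\<rceil>" for t :: real
  have w_small: "w n \<le> t / 2" if "0 < t" "M t \<le> n" for t n
  proof -
    have "(2 / t)\<^sup>2 \<le> real n + 1" using that by (simp add: M_def power_divide nat_le_iff) linarith
    then have "2 / t \<le> sqrt (real n + 1)" by (rule real_le_rsqrt)
    then show ?thesis using that unfolding w_def by (simp add: field_simps)
  qed

  have nulc
  proof (rule nulc_gaugeI[where C = "\<lambda>t. 4 / t + 2 * real (M t)"])
    show "0 < 4 / t + 2 * real (M t)" if "0 < t" for t :: real using that by (simp add: add_pos_nonneg)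
    fix t s :: real and f :: "nat \<Rightarrow> 'k" and L A p
    assume t: "0 < t" "t \<le> 1" and s: "0 < s" and f: "f \<in> carrier" and p: "p \<in> P"
      and ge: "\<And>n. n \<in> L \<Longrightarrow> t * s \<le> norm (f n)" and le: "\<And>n. norm (f n) \<le> s"
      and supp: "\<And>n. n \<notin> L \<Longrightarrow> f n = 0"
    let ?f = "\<lambda>n. if n \<in> A then f n else 0"
    have g0: "0 \<le> gnorm f" by (rule gnorm_nonneg[OF f])
    have f_le: "norm (?f n) \<le> gnorm f" for n using coord_le_gnorm[OF f, of n] g0 by simp
    from p show "p ?f \<le> (4 / t + 2 * real (M t)) * gnorm f"
    proof (cases rule: casesP)
      case (coordinate n)
      have "1 \<le> 4 / t + 2 * real (M t)" using t by (simp add: field_simps add_increasing2)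
      then have "1 * gnorm f \<le> (4 / t + 2 * real (M t)) * gnorm f" by (rule mult_right_mono[OF _ g0])
      then show ?thesis using f_le[of n] unfolding coordinate by linarith
    next
      case (defect m)
      have "norm (defect D w n ?f) \<le>
          4 / t * norm (defect D w n f) + (if n < M t then 2 * gnorm f else 0)" for n
      \<comment> \<open>The first \<open>M t\<close> defects are bounded crudely by two coordinates,
        each at most \<open>gnorm f\<close>; beyond them the weight is too small for
        cancellation.\<close>
      proof (cases "n < M t")
        case True
        have "norm (of_real (w n) * ?f (2 * n + 1)) \<le> 1 * gnorm f"
          unfolding norm_mult by (intro mult_mono f_le) (use w in auto)
        then have "norm (defect D w n ?f) \<le> gnorm f + gnorm f"
          unfolding defect_eq using f_le[of "2 * n"]
            norm_triangle_ineq4[of "?f (2 * n)" "of_real (w n) * ?f (2 * n + 1)"] by linarith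
        moreover have "0 \<le> 4 / t * norm (defect D w n f)" using t by simp
        ultimately show ?thesis using True by simp
      next
        case False
        have "f (2 * n) = 0 \<or> t * s \<le> norm (f (2 * n))" using ge supp by blast
        then show ?thesis
          using norm_defect_restrict_le_of_small[of t f s n D w A] t le w(1)[of n] w_small[of t n] False
          by (simp add: D_def)
      qed
      then have "p ?f \<le> (\<Sum>n<m. 4 / t * norm (defect D w n f) + (if n < M t then 2 * gnorm f else 0))"
        unfolding defect by (rule sum_mono)
      also have "\<dots> = 4 / t * (\<Sum>n<m. norm (defect D w n f)) + (\<Sum>n<m. if n < M t then 2 * gnorm f else 0)"
        by (simp add: sum.distrib sum_distrib_left)
      also have "\<dots> \<le> 4 / t * gnorm f + real (M t) * (2 * gnorm f)"
      proof (intro add_mono mult_left_mono gauge_le_gnorm[OF f defectP])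
        have "(\<Sum>n<m. if n < M t then 2 * gnorm f else 0) = (\<Sum>n\<in>{..<m} \<inter> {..<M t}. 2 * gnorm f)"
          by (subst sum.inter_restrict) simp_all
        also have "\<dots> \<le> (\<Sum>n<M t. 2 * gnorm f)" by (rule sum_mono2) (use g0 in auto)
        finally show "(\<Sum>n<m. if n < M t then 2 * gnorm f else 0) \<le> real (M t) * (2 * gnorm f)" by simp
      qed (use t in simp)
      finally show ?thesis by (simp add: algebra_simps)
    qed
  qed
  moreover have "\<not> lpu"
  proof
    assume lpu
    then obtain C where "C \<ge> 1" and C: "\<And>A a b. finite A \<Longrightarrow>
        (SUP n\<in>A. norm (b n)) \<le> (INF n\<in>A. norm (a n)) \<Longrightarrow>
      gnorm (\<Sum>n\<in>A. seq_scale (b n) (unit_seq n)) \<le> C * gnorm (\<Sum>n\<in>A. seq_scale (a n) (unit_seq n))"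
      unfolding lpu_def by meson
    \<comment> \<open>LPU will give \<open>N \<le> C * sqrt N\<close>, that is
      \<open>N \<le> C\<^sup>2\<close>.\<close>
    obtain N :: nat where N: "C\<^sup>2 < N" using reals_Archimedean2 by blast
    have "1 \<le> C\<^sup>2" using \<open>C \<ge> 1\<close> by simp
    then have N1: "1 \<le> real N" using N by linarith
    define A where "A = {..<2 * N}"
    have A: "finite A" "A \<noteq> {}" using N1 by (auto simp: A_def lessThan_empty_iff)
    \<comment> \<open>The odd coefficients cancel every defect, leaving the largest coefficient
      \<open>sqrt N\<close> as a bound for the norm. All moduli are at least 1, so LPU permits
      comparison with the even part alone.\<close>
    define a :: "nat \<Rightarrow> 'k" where "a k = (if even k then 1 else of_real (sqrt (real (k div 2) + 1)))" for k
    define b :: "nat \<Rightarrow> 'k" where "b k = (if even k then 1 else 0)" for k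
    define f where "f = (\<Sum>n\<in>A. seq_scale (a n) (unit_seq n))"
    define g where "g = (\<Sum>n\<in>A. seq_scale (b n) (unit_seq n))"
    have f: "f k = (if k < 2 * N then a k else 0)" and g: "g k = (if k < 2 * N then b k else 0)" for k
      unfolding f_def g_def lincomb_unit_seq[OF A(1)] by (simp_all add: A_def)
    have "(SUP n\<in>A. norm (b n)) \<le> 1" by (rule cSUP_least[OF A(2)]) (simp add: b_def)
    also have "1 \<le> (INF n\<in>A. norm (a n))" by (rule cINF_greatest[OF A(2)]) (simp add: a_def)
    finally have "gnorm g \<le> C * gnorm f" unfolding f_def g_def by (rule C[OF A(1)])
    also have "\<dots> \<le> C * sqrt N"
    proof (rule mult_left_mono)
      show "gnorm f \<le> sqrt N"
      proof (rule gnorm_le)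
        fix p assume "p \<in> P"
        then show "p f \<le> sqrt N"
        proof (cases rule: casesP)
          case (coordinate n)
          have "real (n div 2) + 1 \<le> N" if "n < 2 * N"
            using less_mult_imp_div_less[of n N 2] that by (simp add: mult.commute)
          then show ?thesis using N1 unfolding coordinate by (auto simp: f a_def)
        next
          case (defect m)
          have "defect D w n f = 0" for n
          proof -
            \<comment> \<open>The cut at \<open>2 * N\<close> never separates the two members of a
              pair.\<close>
            have "2 * n + 1 < 2 * N \<longleftrightarrow> 2 * n < 2 * N" by presburger
            moreover have "w n * sqrt (real n + 1) = 1" by (simp add: w_def)
            then have "of_real (w n) * (of_real (sqrt (real n + 1)) :: 'k) = 1" by (metis of_real_1 of_real_mult)
            ultimately show ?thesis unfolding defect_eq f by (simp add: a_def)
          qed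
          then show ?thesis using defect by simp
        qed
      qed
    qed (use \<open>C \<ge> 1\<close> in simp)
    finally have "gnorm g \<le> C * sqrt N" .
    moreover have "real N \<le> gnorm g"
    proof -
      have "defect D w n g = (if n < N then 1 else 0)" for n unfolding defect_eq g by (simp add: b_def)
      then have "real N = (\<Sum>n<N. norm (defect D w n g))" by simp
      also have "\<dots> \<le> gnorm g"
        by (rule gauge_le_gnorm[OF _ defectP]) (simp add: g_def lincomb_in_X)
      finally show ?thesis .
    qed
    ultimately have "sqrt N * sqrt N \<le> C * sqrt N" by simp
    then have "sqrt N \<le> C" by (rule mult_right_le_imp_le) (use N1 in simp)
    then have "N \<le> C\<^sup>2" by (rule sqrt_le_D)
    then show False using N by simp
  qed
  ultimately show ?thesis using quasi_banach_basis_axioms by blast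
qed

theorem corollary4p6:
  shows
    "(\<forall>(scale :: real \<Rightarrow> 'v::ab_group_add \<Rightarrow> 'v) X qnorm x xs.
        quasi_banach_basis scale X qnorm x xs \<longrightarrow>
          (quasi_banach_basis.nearly_unconditional scale X qnorm x xs \<longrightarrow>
            quasi_banach_basis.nulc scale X qnorm x xs) \<and>
          (quasi_banach_basis.lpu scale qnorm x \<longrightarrow>
            quasi_banach_basis.nulc scale X qnorm x xs)) \<and>
     (\<forall>(scale :: complex \<Rightarrow> 'w::ab_group_add \<Rightarrow> 'w) X qnorm x xs.
        quasi_banach_basis scale X qnorm x xs \<longrightarrow>
          (quasi_banach_basis.nearly_unconditional scale X qnorm x xs \<longrightarrow>
            quasi_banach_basis.nulc scale X qnorm x xs) \<and>
          (quasi_banach_basis.lpu scale qnorm x \<longrightarrow>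
            quasi_banach_basis.nulc scale X qnorm x xs)) \<and>
     (\<exists>(X :: (nat \<Rightarrow> real) set) qnorm x xs.
        quasi_banach_basis seq_scale X qnorm x xs \<and>
        quasi_banach_basis.nulc seq_scale X qnorm x xs \<and>
        \<not> quasi_banach_basis.nearly_unconditional seq_scale X qnorm x xs) \<and>
     (\<exists>(X :: (nat \<Rightarrow> complex) set) qnorm x xs.
        quasi_banach_basis seq_scale X qnorm x xs \<and>
        quasi_banach_basis.nulc seq_scale X qnorm x xs \<and>
        \<not> quasi_banach_basis.nearly_unconditional seq_scale X qnorm x xs) \<and>
     (\<exists>(X :: (nat \<Rightarrow> real) set) qnorm x xs.
        quasi_banach_basis seq_scale X qnorm x xs \<and>
        quasi_banach_basis.nulc seq_scale X qnorm x xs \<and>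
        \<not> quasi_banach_basis.lpu seq_scale qnorm x) \<and>
     (\<exists>(X :: (nat \<Rightarrow> complex) set) qnorm x xs.
        quasi_banach_basis seq_scale X qnorm x xs \<and>
        quasi_banach_basis.nulc seq_scale X qnorm x xs \<and>
        \<not> quasi_banach_basis.lpu seq_scale qnorm x)"
  by (intro conjI allI impI quasi_banach_basis.nulc_if_nearly_unconditional
      quasi_banach_basis.nulc_if_lpu ex_nulc_not_nearly_unconditional ex_nulc_not_lpu)

end
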